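(* Let $\mathfrak g$ be a real Lie algebra which is a semidirect product of $\mathbb R e_0$ and a $(2n-1)$-dimensional abelian ideal such that $\operatorname{ad}_{e_0}$ diagonalizes and the eigenvalues $\lambda_1,\dots,\lambda_{2n-1}$ of $\operatorname{ad}_{e_0}$ on this ideal satisfy $\lambda_i+\lambda_j\neq0$ for all $i,j$. Then $\mathfrak g$ cannot be equipped with a symplectic structure.
   Context: A symplectic structure on a $2n$-dimensional Lie algebra is a closed (Chevalley–Eilenberg, trivial coefficients) 2-form $\omega$ with $\omega^n\neq0$. Here $\operatorname{ad}_{e_0}$ denotes the map $x\mapsto[e_0,x]$.
   Formalization: The formal statement assumes n ≥ 2; for n = 1 the claim is false, since the hypotheses force [e_0,e_1] = λe_1 with λ ≠ 0, and this 2-dimensional Lie algebra carries the symplectic form e^0∧e^1. *)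

theory Defs
  imports "HOL-Analysis.Analysis" "HOL-Combinatorics.Permutations"
begin

locale real_lie_algebra =
  fixes br :: "'a::real_vector \<Rightarrow> 'a \<Rightarrow> 'a"
  assumes bilinear_br: "bilinear br"
    and br_self: "br x x = 0"
    and jacobi: "br x (br y z) + br y (br z x) + br z (br x y) = 0"

definition lie_subalgebra :: "('a::real_vector \<Rightarrow> 'a \<Rightarrow> 'a) \<Rightarrow> 'a set \<Rightarrow> bool" where
  "lie_subalgebra br K \<longleftrightarrow> subspace K \<and> (\<forall>x\<in>K. \<forall>y\<in>K. br x y \<in> K)"

definition lie_ideal :: "('a::real_vector \<Rightarrow> 'a \<Rightarrow> 'a) \<Rightarrow> 'a set \<Rightarrow> bool" where
  "lie_ideal br I \<longleftrightarrow> subspace I \<and> (\<forall>x. \<forall>y\<in>I. br x y \<in> I)"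

definition abelian_on :: "('a::real_vector \<Rightarrow> 'a \<Rightarrow> 'a) \<Rightarrow> 'a set \<Rightarrow> bool" where
  "abelian_on br I \<longleftrightarrow> (\<forall>x\<in>I. \<forall>y\<in>I. br x y = 0)"

text \<open>Internal semidirect product: the whole Lie algebra (the underlying type) is the vector
  space direct sum of the subalgebra \<open>K\<close> and the ideal \<open>I\<close>.\<close>

definition semidirect_product ::
    "('a::real_vector \<Rightarrow> 'a \<Rightarrow> 'a) \<Rightarrow> 'a set \<Rightarrow> 'a set \<Rightarrow> bool" where
  "semidirect_product br K I \<longleftrightarrow>
     lie_subalgebra br K \<and> lie_ideal br I \<and> K \<inter> I = {0} \<and> {x + y | x y. x \<in> K \<and> y \<in> I} = UNIV"

definition diagonalizable :: "('a::real_vector \<Rightarrow> 'a) \<Rightarrow> bool" where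
  "diagonalizable f \<longleftrightarrow>
     (\<exists>B. independent B \<and> span B = UNIV \<and> (\<forall>b\<in>B. \<exists>c. f b = c *\<^sub>R b))"

definition eigenspace_on :: "'a::real_vector set \<Rightarrow> ('a \<Rightarrow> 'a) \<Rightarrow> real \<Rightarrow> 'a set" where
  "eigenspace_on V f c = {x \<in> V. f x = c *\<^sub>R x}"

text \<open>\<open>ev 1, \<dots>, ev m\<close> is the list of eigenvalues of \<open>f\<close> on the invariant subspace \<open>V\<close>, in some
  order, each repeated according to its (geometric) multiplicity; for diagonalizable \<open>f\<close> this is
  the algebraic multiplicity as well.\<close>

definition eigenvalues_on ::
    "'a::real_vector set \<Rightarrow> ('a \<Rightarrow> 'a) \<Rightarrow> nat \<Rightarrow> (nat \<Rightarrow> real) \<Rightarrow> bool" where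
  "eigenvalues_on V f m ev \<longleftrightarrow>
     (\<forall>c. card {i \<in> {1..m}. ev i = c} = dim (eigenspace_on V f c))"

text \<open>A \<open>k\<close>-form is represented by a function on argument lists of which only the values
  on lists of length \<open>k\<close> matter.\<close>

definition alternating_form :: "nat \<Rightarrow> ('a::real_vector list \<Rightarrow> real) \<Rightarrow> bool" where
  "alternating_form k \<alpha> \<longleftrightarrow>
     (\<forall>xs. length xs = k \<longrightarrow>
        (\<forall>i<k. linear (\<lambda>x. \<alpha> (xs[i := x]))) \<and>
        (\<forall>i<k. \<forall>j<k. i \<noteq> j \<and> xs ! i = xs ! j \<longrightarrow> \<alpha> xs = 0))"

text \<open>Exterior product of a \<open>k\<close>-form and an \<open>l\<close>-form, normalized so that the exterior
  product of dual basis covectors is a determinant.\<close>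

definition wedge ::
    "nat \<Rightarrow> nat \<Rightarrow> ('a list \<Rightarrow> real) \<Rightarrow> ('a list \<Rightarrow> real) \<Rightarrow> 'a list \<Rightarrow> real" where
  "wedge k l \<alpha> \<beta> xs =
     (\<Sum>\<sigma> | \<sigma> permutes {..<k + l}.
        of_int (sign \<sigma>) * \<alpha> (map (\<lambda>i. xs ! \<sigma> i) [0..<k]) * \<beta> (map (\<lambda>i. xs ! \<sigma> i) [k..<k + l]))
     / (fact k * fact l)"

text \<open>The \<open>n\<close>-fold exterior power of a \<open>k\<close>-form, a \<open>k * n\<close>-form.\<close>

fun wedge_power :: "nat \<Rightarrow> nat \<Rightarrow> ('a list \<Rightarrow> real) \<Rightarrow> 'a list \<Rightarrow> real" where
  "wedge_power k 0 \<alpha> = (\<lambda>xs. 1)"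
| "wedge_power k (Suc n) \<alpha> = wedge k (k * n) \<alpha> (wedge_power k n \<alpha>)"

text \<open>Chevalley--Eilenberg differential of a \<open>k\<close>-form with trivial coefficients:
  \<open>(d\<alpha>)(x\<^sub>0, \<dots>, x\<^sub>k)\<close> is the sum over \<open>i < j\<close> of \<open>(-1)\<close> to the power \<open>i + j\<close> times
  \<open>\<alpha>([x\<^sub>i, x\<^sub>j], x\<^sub>0, \<dots>, x\<^sub>k)\<close> with \<open>x\<^sub>i\<close> and \<open>x\<^sub>j\<close> omitted from the trailing arguments.\<close>

definition ce_differential ::
    "('a::real_vector \<Rightarrow> 'a \<Rightarrow> 'a) \<Rightarrow> nat \<Rightarrow> ('a list \<Rightarrow> real) \<Rightarrow> 'a list \<Rightarrow> real" where
  "ce_differential br k \<alpha> xs =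
     (\<Sum>(i, j) | i < j \<and> j \<le> k.
        (-1) ^ (i + j) * \<alpha> (br (xs ! i) (xs ! j) # nths xs ({..k} - {i, j})))"

definition ce_closed ::
    "('a::real_vector \<Rightarrow> 'a \<Rightarrow> 'a) \<Rightarrow> nat \<Rightarrow> ('a list \<Rightarrow> real) \<Rightarrow> bool" where
  "ce_closed br k \<alpha> \<longleftrightarrow> (\<forall>xs. length xs = Suc k \<longrightarrow> ce_differential br k \<alpha> xs = 0)"

text \<open>The explicit finite spanning set is needed because \<open>dim\<close> is \<open>0\<close> on
  infinite-dimensional spaces.\<close>

definition symplectic_structure ::
    "('a::real_vector \<Rightarrow> 'a \<Rightarrow> 'a) \<Rightarrow> ('a list \<Rightarrow> real) \<Rightarrow> bool" where
  "symplectic_structure br \<omega> \<longleftrightarrow>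
     (\<exists>B :: 'a set. finite B \<and> span B = UNIV) \<and>
     alternating_form 2 \<omega> \<and> ce_closed br 2 \<omega> \<and>
     (\<exists>n. dim (UNIV :: 'a set) = 2 * n \<and>
          (\<exists>xs. length xs = 2 * n \<and> wedge_power 2 n \<omega> xs \<noteq> 0))"

end

theory Submission
  imports Defs
begin

text \<open>The idea is that the abelian ideal \<open>I\<close>, a hyperplane, is isotropic for every closed 2-form
  \<open>\<omega>\<close>, and that a 2-form with an isotropic hyperplane is too degenerate to be symplectic in
  dimension at least 4.

  Isotropy: as \<open>I\<close> is abelian, closedness evaluated on \<open>e0, x, y\<close> with \<open>x, y\<close> in \<open>I\<close> says that
  \<open>D = [e0, \<cdot>]\<close> is skew for \<open>\<omega>\<close>, that is \<open>\<omega>(D x, y) + \<omega>(x, D y) = 0\<close>. For eigenvectors \<open>x, y\<close>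
  with eigenvalues \<open>c, d\<close> this reads \<open>(c + d) \<omega>(x, y) = 0\<close>, and \<open>c + d \<noteq> 0\<close> by assumption. Since
  \<open>D\<close> is diagonalizable and kills \<open>e0\<close>, eigenvectors span \<open>I\<close> (\<open>eigenvectors_span_hyperplane\<close>),
  so \<open>\<omega>\<close> vanishes on \<open>I \<times> I\<close> (\<open>skew_imp_isotropic\<close>).

  Degeneracy: if \<open>t\<close> is the \<open>e0\<close>-coordinate along \<open>I\<close> and \<open>\<eta> = \<omega>(e0, \<cdot>)\<close>, then isotropy means
  \<open>\<omega> = t \<and> \<eta>\<close>. Hence \<open>\<omega> \<and> \<omega> = 0\<close> (\<open>wedge_power_2_decomposable\<close>), and so all higher powers of
  \<open>\<omega>\<close> vanish as well.\<close>

section \<open>Powers of a decomposable 2-form\<close>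

text \<open>Composing with the transposition of \<open>a\<close> and \<open>b\<close> reverses the sign of every permutation, so
  the antisymmetrization of an expression that is symmetric in the positions \<open>a\<close> and \<open>b\<close> cancels
  in pairs.\<close>

lemma sum_sign_symmetric_eq_0:
  fixes f :: "('i \<Rightarrow> 'i) \<Rightarrow> real"
  assumes S: "finite S" "a \<in> S" "b \<in> S" and "a \<noteq> b"
    and sym: "\<And>\<sigma>. f (\<sigma> \<circ> Transposition.transpose a b) = f \<sigma>"
  shows "(\<Sum>\<sigma> | \<sigma> permutes S. of_int (sign \<sigma>) * f \<sigma>) = 0"
proof -
  let ?t = "Transposition.transpose a b"
  have t: "?t permutes S" using S by (simp add: permutes_swap_id)
  have sgn: "sign (\<sigma> \<circ> ?t) = - sign \<sigma>" if "\<sigma> permutes S" for \<sigma>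
  proof -
    have "permutation \<sigma>" "permutation ?t"
      using that t S(1) permutation_permutes by blast+
    then show ?thesis
      using \<open>a \<noteq> b\<close> by (simp add: sign_compose sign_swap_id)
  qed
  have "(\<Sum>\<sigma> | \<sigma> permutes S. of_int (sign \<sigma>) * f \<sigma>)
      = (\<Sum>\<sigma> | \<sigma> permutes S. of_int (sign (\<sigma> \<circ> ?t)) * f (\<sigma> \<circ> ?t))"
    by (rule sum_permutations_compose_right[OF t])
  also have "\<dots> = (\<Sum>\<sigma> | \<sigma> permutes S. - (of_int (sign \<sigma>) * f \<sigma>))"
    by (rule sum.cong) (simp_all add: sgn sym)
  finally show ?thesis by (simp add: sum_negf)
qed

lemma wedge_power_1_of_skew:
  assumes skew: "\<And>x y. \<omega> [y, x] = - \<omega> [x, y]"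
  shows "wedge_power 2 (Suc 0) \<omega> [x, y] = \<omega> [x, y]"
proof -
  have S: "{..<2::nat} = insert 0 {1}" by auto
  have P: "{\<sigma>. \<sigma> permutes {..<2::nat}} = {id, Transposition.transpose 0 1}"
    by (auto simp: S permutes_doubleton_iff)
  have ne: "id \<noteq> Transposition.transpose (0::nat) 1"
    by (metis id_apply transpose_apply_first zero_neq_one)
  have m: "[0..<2] = [0, 1::nat]" by (simp add: upt_conv_Cons)
  show ?thesis
    using ne skew[of y x]
    by (simp add: wedge_def P m sign_swap_id)
qed

text \<open>If \<open>\<omega> = t \<and> \<eta>\<close>, then each monomial of the expansion of \<open>\<omega> \<and> \<omega>\<close> contains the factor \<open>t\<close>
  at two different positions, and is thus symmetric in them.\<close>

lemma wedge_power_2_decomposable: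
  assumes dec: "\<And>x y. \<omega> [x, y] = t x * \<eta> y - t y * \<eta> x"
  shows "wedge_power 2 2 \<omega> xs = 0"
proof -
  have one: "wedge_power 2 (Suc 0) \<omega> [x, y] = \<omega> [x, y]" for x y
    by (rule wedge_power_1_of_skew) (simp add: dec)
  let ?S = "{..<4::nat}"
  \<comment> \<open>\<open>M a b c d\<close> has its \<open>t\<close>-factors at \<open>a, c\<close> and its \<open>\<eta>\<close>-factors at \<open>b, d\<close>.\<close>
  define T where "T = (\<lambda>i. t (xs ! i))"
  define E where "E = (\<lambda>i. \<eta> (xs ! i))"
  define M where "M = (\<lambda>a b c d (\<sigma>::nat \<Rightarrow> nat). T (\<sigma> a) * E (\<sigma> b) * T (\<sigma> c) * E (\<sigma> d))"
  have M0: "(\<Sum>\<sigma> | \<sigma> permutes ?S. of_int (sign \<sigma>) * M a b c d \<sigma>) = 0"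
    if "a < 4" "c < 4" "a \<noteq> c" "b \<notin> {a, c}" "d \<notin> {a, c}" for a b c d
    using that
    by (intro sum_sign_symmetric_eq_0[of _ a c]) (auto simp: M_def Transposition.transpose_def)
  have expand: "of_int (sign \<sigma>) * \<omega> [xs ! \<sigma> 0, xs ! \<sigma> 1] * \<omega> [xs ! \<sigma> 2, xs ! \<sigma> 3]
      = of_int (sign \<sigma>) * M 0 1 2 3 \<sigma> - of_int (sign \<sigma>) * M 0 1 3 2 \<sigma>
        - of_int (sign \<sigma>) * M 1 0 2 3 \<sigma> + of_int (sign \<sigma>) * M 1 0 3 2 \<sigma>" for \<sigma>
    by (simp add: dec M_def T_def E_def algebra_simps)
  have l: "[0..<2] = [0, 1::nat]" "[2..<4] = [2, 3::nat]"
    by (simp_all add: upt_conv_Cons)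
  have "wedge_power 2 2 \<omega> xs
      = (\<Sum>\<sigma> | \<sigma> permutes ?S.
          of_int (sign \<sigma>) * \<omega> [xs ! \<sigma> 0, xs ! \<sigma> 1] * \<omega> [xs ! \<sigma> 2, xs ! \<sigma> 3]) / 4"
  proof -
    have "wedge_power 2 2 \<omega> = wedge 2 2 \<omega> (wedge_power 2 (Suc 0) \<omega>)"
      by (simp only: numeral_2_eq_2 wedge_power.simps) simp
    then show ?thesis
      by (simp add: wedge_def l one del: wedge_power.simps One_nat_def)
  qed
  also have "\<dots> = 0"
    unfolding expand by (simp add: sum.distrib sum_subtractf M0 del: One_nat_def)
  finally show ?thesis .
qed

lemma wedge_power_eq_0_mono:
  assumes "\<And>xs. wedge_power k m \<omega> xs = 0" and "m \<le> n"
  shows "wedge_power k n \<omega> xs = 0"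
  using assms(2) by (induction n arbitrary: xs rule: dec_induct) (simp_all add: assms(1) wedge_def)

section \<open>Eigenvectors in the ideal\<close>

text \<open>An eigenvector for a nonzero eigenvalue already lies in \<open>I\<close>, because \<open>f\<close> maps everything
  into \<open>I\<close>; an eigenvector for the eigenvalue \<open>0\<close> can be moved into \<open>I\<close> by subtracting a multiple
  of \<open>e\<close>, which \<open>f\<close> kills.\<close>

lemma eigenvectors_span_hyperplane:
  fixes f :: "'a::real_vector \<Rightarrow> 'a"
  assumes f: "linear f" "f e = 0" "\<And>x. x \<in> I \<Longrightarrow> f x \<in> I"
    and I: "subspace I" "span {e} \<inter> I = {0}"
    and dec: "\<And>x. \<exists>r. \<exists>u\<in>I. x = r *\<^sub>R e + u"
    and diag: "diagonalizable f"
  shows "I \<subseteq> span {x \<in> I. \<exists>c. f x = c *\<^sub>R x}"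
proof
  let ?E = "{x \<in> I. \<exists>c. f x = c *\<^sub>R x}"
  fix x assume x: "x \<in> I"
  obtain B where B: "span B = UNIV" "\<And>b. b \<in> B \<Longrightarrow> \<exists>c. f b = c *\<^sub>R b"
    using diag unfolding diagonalizable_def by blast
  have "b \<in> span (insert e ?E)" if b: "b \<in> B" for b
  proof -
    obtain c where c: "f b = c *\<^sub>R b" using B(2) b by blast
    obtain r u where u: "u \<in> I" "b = r *\<^sub>R e + u" using dec by blast
    have fb: "f b = f u"
      using f(1,2) by (simp add: u(2) linear_add linear_scale)
    have "u \<in> ?E"
    proof (cases "c = 0")
      case True
      then have "f u = 0 *\<^sub>R u" using c fb by simp
      then show ?thesis using u(1) by blast
    next
      case False
      have "c *\<^sub>R b \<in> I" using f(3)[OF u(1)] c fb by simp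
      then have "(1 / c) *\<^sub>R (c *\<^sub>R b) \<in> I" using I(1) subspace_scale by blast
      then have "b \<in> I" using False by simp
      then have "r *\<^sub>R e \<in> I"
        using u I(1) by (metis add_diff_cancel_right' subspace_diff)
      then have "r *\<^sub>R e = 0"
        using I(2) span_scale[OF span_base, of e "{e}" r] by blast
      then have "b = u" using u(2) by simp
      then show ?thesis using u(1) c by blast
    qed
    then show ?thesis
      unfolding u(2) by (intro span_add span_scale span_base) auto
  qed
  then have "span B \<subseteq> span (insert e ?E)"
    by (intro span_minimal subspace_span) blast
  then have "span (insert e ?E) = UNIV"
    using B(1) by blast
  then obtain k where k: "x - k *\<^sub>R e \<in> span ?E"
    using span_breakdown_eq[of x e ?E] by auto
  moreover have "span ?E \<subseteq> I"
    using I(1) by (intro span_minimal) auto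
  ultimately have "x - k *\<^sub>R e \<in> I" by blast
  then have "x - (x - k *\<^sub>R e) \<in> I" by (rule subspace_diff[OF I(1) x])
  then have "k *\<^sub>R e \<in> I" by simp
  then have "k *\<^sub>R e = 0"
    using I(2) span_scale[OF span_base, of e "{e}" k] by blast
  then show "x \<in> span ?E" using k by (simp only: diff_zero)
qed

text \<open>The value \<open>dim = 0\<close> also occurs for spaces without a finite basis, so that a finite spanning
  set is needed to conclude from a nonzero eigenvector that its eigenvalue is listed.\<close>

lemma eigenvalue_listed:
  fixes f :: "'a::real_vector \<Rightarrow> 'a"
  assumes fin: "finite B" "span B = (UNIV :: 'a set)"
    and ev: "eigenvalues_on V f m ev"
    and x: "x \<in> V" "f x = c *\<^sub>R x" "x \<noteq> 0"
  shows "\<exists>i\<in>{1..m}. ev i = c"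
proof -
  let ?W = "eigenspace_on V f c"
  obtain C where C: "C \<subseteq> ?W" "independent C" "?W \<subseteq> span C" "card C = dim ?W"
    using basis_exists by blast
  have "finite C" using independent_span_bound[OF fin(1) C(2)] fin(2) by simp
  have "C \<noteq> {}"
  proof
    assume "C = {}"
    then have "x \<in> {0}" using C(3) x by (auto simp: eigenspace_on_def)
    then show False using x(3) by simp
  qed
  then have "dim ?W \<noteq> 0" using C(4) \<open>finite C\<close> by (metis card_eq_0_iff)
  then have "card {i \<in> {1..m}. ev i = c} \<noteq> 0"
    using ev by (simp add: eigenvalues_on_def)
  then have "{i \<in> {1..m}. ev i = c} \<noteq> {}" by (metis card.empty)
  then show ?thesis by blast
qed

lemma dim_le_dim_UNIV:
  fixes V :: "'a::real_vector set"
  assumes "finite B" "span B = (UNIV :: 'a set)"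
  shows "dim V \<le> dim (UNIV :: 'a set)"
proof -
  obtain C :: "'a set" where C: "independent C" "card C = dim V"
    using basis_exists by blast
  obtain A :: "'a set" where A: "independent A" "UNIV \<subseteq> span A" "card A = dim (UNIV :: 'a set)"
    using basis_exists by blast
  have "finite A" using independent_span_bound[OF assms(1) A(1)] assms(2) by simp
  then show ?thesis
    using independent_span_bound[of A C] C A by auto
qed

section \<open>Isotropy of the ideal\<close>

lemma alternating_form_2D:
  assumes "alternating_form 2 \<omega>"
  shows "linear (\<lambda>x. \<omega> [x, y])" "linear (\<lambda>x. \<omega> [y, x])" "\<omega> [x, x] = 0"
    "\<omega> [y, x] = - \<omega> [x, y]"
proof -
  have lin: "linear (\<lambda>x. \<omega> ([a, b][i := x]))" if "i < 2" for a b i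
    using assms that unfolding alternating_form_def
    by (metis One_nat_def Suc_1 length_Cons list.size(3))
  have l1: "linear (\<lambda>x. \<omega> [x, y])" and l2: "linear (\<lambda>x. \<omega> [y, x])" for y
    using lin[of 0 y y] lin[of 1 y y] by simp_all
  have "\<omega> xs = 0" if "length xs = 2" "xs ! 0 = xs ! 1" for xs
    using assms that unfolding alternating_form_def by (metis one_less_numeral_iff pos2
        semiring_norm(76) zero_neq_one)
  from this[of "[x, x]" for x] have z: "\<omega> [x, x] = 0" for x
    by simp
  have "0 = \<omega> [x + y, x + y]" by (simp add: z)
  also have "\<dots> = \<omega> [x, y] + \<omega> [y, x]"
    unfolding linear_add[OF l1] linear_add[OF l2] by (simp add: z)
  finally show "\<omega> [y, x] = - \<omega> [x, y]" by linarith
  show "linear (\<lambda>x. \<omega> [x, y])" "linear (\<lambda>x. \<omega> [y, x])" "\<omega> [x, x] = 0"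
    by (fact l1 l2 z)+
qed

lemma ce_closed_2D:
  assumes "ce_closed br 2 \<omega>"
  shows "\<omega> [br x z, y] = \<omega> [br x y, z] + \<omega> [br y z, x]"
proof -
  have P: "{(i, j). i < j \<and> j \<le> 2} = {(0, 1), (0, 2), (1, 2::nat)}" by auto
  have N: "nths [x, y, z] ({..2} - {0, 1}) = [z]" "nths [x, y, z] ({..2} - {0, 2}) = [y]"
    "nths [x, y, z] ({..2} - {1, 2}) = [x]"
    by (simp_all add: nths_Cons)
  have "ce_differential br 2 \<omega> [x, y, z] = 0"
    using assms by (simp add: ce_closed_def)
  then show ?thesis
    unfolding ce_differential_def P by (simp add: N[simplified])
qed

text \<open>The set \<open>\<Lambda>\<close> contains the eigenvalues of \<open>f\<close>. Skewness makes eigenvectors for \<open>c\<close> and \<open>d\<close>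
  orthogonal unless \<open>c + d = 0\<close>; the case \<open>c = d\<close> is included, so that also a single eigenspace is
  isotropic. Bilinearity extends this to the span.\<close>

lemma skew_imp_isotropic:
  assumes lin: "\<And>y. linear (\<lambda>x. w x y)" "\<And>x. linear (\<lambda>y. w x y :: real)"
    and skew: "\<And>x y. x \<in> E \<Longrightarrow> y \<in> E \<Longrightarrow> w (f x) y + w x (f y) = 0"
    and eig: "\<And>x. x \<in> E \<Longrightarrow> \<exists>c\<in>\<Lambda>. f x = c *\<^sub>R x"
    and nonres: "\<And>c d. c \<in> \<Lambda> \<Longrightarrow> d \<in> \<Lambda> \<Longrightarrow> c + d \<noteq> 0"
    and xy: "x \<in> span E" "y \<in> span E"
  shows "w x y = 0"
proof -
  have E: "w x y = 0" if xyE: "x \<in> E" "y \<in> E" for x y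
  proof -
    obtain c d where cd: "c \<in> \<Lambda>" "f x = c *\<^sub>R x" "d \<in> \<Lambda>" "f y = d *\<^sub>R y"
      using eig[OF xyE(1)] eig[OF xyE(2)] by blast
    then have "(c + d) * w x y = 0"
      using skew[OF xyE] by (simp add: linear_scale[OF lin(1)] linear_scale[OF lin(2)] algebra_simps)
    then show ?thesis using nonres cd by simp
  qed
  have "w x y = 0" if "x \<in> E" for x
    using linear_eq_0_on_span[OF lin(2) _ xy(2)] E that by blast
  then show ?thesis
    using linear_eq_0_on_span[OF lin(1) _ xy(1)] by blast
qed

section \<open>Absence of symplectic structures\<close>

theorem proposition4p5:
  fixes br :: "'a::real_vector \<Rightarrow> 'a \<Rightarrow> 'a"
    and e0 :: 'a
    and I :: "'a set"
    and n :: nat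
    and ev :: "nat \<Rightarrow> real"
  assumes "real_lie_algebra br"
    and "n \<ge> 2"
    and "e0 \<noteq> 0"
    and "semidirect_product br (span {e0}) I"
    and "dim I = 2 * n - 1"
    and "abelian_on br I"
    and "diagonalizable (\<lambda>x. br e0 x)"
    and "eigenvalues_on I (\<lambda>x. br e0 x) (2 * n - 1) ev"
    and "\<forall>i\<in>{1..2 * n - 1}. \<forall>j\<in>{1..2 * n - 1}. ev i + ev j \<noteq> 0"
  shows "\<not> (\<exists>\<omega>. symplectic_structure br \<omega>)"
proof
  assume "\<exists>\<omega>. symplectic_structure br \<omega>"
  then obtain \<omega> B m xs where fin: "finite B" "span B = (UNIV :: 'a set)"
    and alt: "alternating_form 2 \<omega>" and closed: "ce_closed br 2 \<omega>"
    and m: "dim (UNIV :: 'a set) = 2 * m" and nz: "wedge_power 2 m \<omega> xs \<noteq> 0"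
    unfolding symplectic_structure_def by blast
  interpret real_lie_algebra br by fact
  have lin: "linear (br e0)" using bilinear_br by (simp add: bilinear_def)
  have I: "subspace I" "\<And>x. x \<in> I \<Longrightarrow> br e0 x \<in> I" "span {e0} \<inter> I = {0}"
    and sum: "{x + y | x y. x \<in> span {e0} \<and> y \<in> I} = UNIV"
    using assms(4) by (auto simp: semidirect_product_def lie_ideal_def)
  have dec: "\<exists>r. \<exists>u\<in>I. x = r *\<^sub>R e0 + u" for x
  proof -
    have "x \<in> {x + y | x y. x \<in> span {e0} \<and> y \<in> I}" unfolding sum by simp
    then show ?thesis by (auto simp: span_singleton)
  qed
  \<comment> \<open>Every scalar satisfies the eigenvalue equation of the vector \<open>0\<close>, which is excluded so that
    the scalars occurring below are true eigenvalues.\<close>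
  define E where "E = {x \<in> I. \<exists>c. br e0 x = c *\<^sub>R x} - {0}"
  have spanE: "I \<subseteq> span E"
    using eigenvectors_span_hyperplane[OF lin br_self I(2,1,3) dec assms(7)]
    by (simp add: E_def)
  have iso: "\<omega> [x, y] = 0" if "x \<in> I" "y \<in> I" for x y
  proof (rule skew_imp_isotropic[of "\<lambda>x y. \<omega> [x, y]" E "br e0" "ev ` {1..2 * n - 1}"])
    fix x y assume "x \<in> E" "y \<in> E"
    then have "br x y = 0" using assms(6) by (simp add: abelian_on_def E_def)
    then show "\<omega> [br e0 x, y] + \<omega> [x, br e0 y] = 0"
      using ce_closed_2D[OF closed, of e0 y x] alternating_form_2D(4)[OF alt, of x "br e0 y"]
        linear_0[OF alternating_form_2D(1)[OF alt]]
      by simp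
  next
    fix x assume "x \<in> E"
    then show "\<exists>c\<in>ev ` {1..2 * n - 1}. br e0 x = c *\<^sub>R x"
      using eigenvalue_listed[OF fin assms(8)] unfolding E_def by blast
  next
    show "x \<in> span E" "y \<in> span E" using that spanE by auto
  next
    show "c + d \<noteq> 0" if "c \<in> ev ` {1..2 * n - 1}" "d \<in> ev ` {1..2 * n - 1}" for c d
      using assms(9) that by blast
  qed (fact alternating_form_2D(1,2)[OF alt])+
  \<comment> \<open>With isotropy, only the terms pairing \<open>e0\<close> with a component in \<open>I\<close> survive.\<close>
  obtain t where t: "\<And>x. \<exists>u\<in>I. x = t x *\<^sub>R e0 + u" using dec by metis
  have "\<omega> [x, y] = t x * \<omega> [e0, y] - t y * \<omega> [e0, x]" for x y
  proof -
    note alt2 = alternating_form_2D[OF alt]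
    obtain u v where u: "u \<in> I" "x = t x *\<^sub>R e0 + u" and v: "v \<in> I" "y = t y *\<^sub>R e0 + v"
      using t by blast
    \<comment> \<open>General coefficients \<open>r, s\<close> keep the equations for \<open>x\<close> and \<open>y\<close> from being rewritten in a loop.\<close>
    have "\<omega> [r *\<^sub>R e0 + u, s *\<^sub>R e0 + v]
        = r * \<omega> [e0, s *\<^sub>R e0 + v] - s * \<omega> [e0, r *\<^sub>R e0 + u]" for r s
      using iso[OF u(1) v(1)] alt2(4)[of u e0]
      by (simp add: linear_add[OF alt2(1)] linear_add[OF alt2(2)] linear_scale[OF alt2(1)]
          linear_scale[OF alt2(2)] alt2(3) algebra_simps)
    then show ?thesis using u(2) v(2) by metis
  qed
  then have "wedge_power 2 2 \<omega> xs = 0" for xs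
    by (rule wedge_power_2_decomposable[of \<omega> t "\<lambda>x. \<omega> [e0, x]"])
  moreover have "2 \<le> m"
    using dim_le_dim_UNIV[OF fin, of I] m assms(2,5) by linarith
  ultimately show False
    using wedge_power_eq_0_mono nz by blast
qed

end
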